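(* Let $n,s,r$ be positive integers with $r\le \min(n,s)$, let $\mathbf V\in\mathbb R^{n\times s}$, and let $\mathbf p=[p_1,\dots,p_r]$ and $\mathbf s=[s_1,\dots,s_r]$ be vectors of distinct row indices in $\{1,\dots,n\}$ and distinct column indices in $\{1,\dots,s\}$, with indexing matrices $\mathbf P=\mathbf I_n(:,\mathbf p)\in\mathbb R^{n\times r}$ and $\mathbf S=\mathbf I_s(:,\mathbf s)\in\mathbb R^{s\times r}$. Let $\hat{\mathbf V}=\mathbf Q\mathbf Z$ be the low-rank approximation of $\mathbf V$ computed by the TDB-CUR algorithm: $\mathbf V(:,\mathbf s)=\mathbf Q\mathbf R$ is a QR decomposition with $\mathbf Q\in\mathbb R^{n\times r}$ having orthonormal columns and $\mathbf R\in\mathbb R^{r\times r}$, the matrix $\mathbf Q(\mathbf p,:)=\mathbf P^T\mathbf Q$ is invertible, and $\mathbf Z=\mathbf Q(\mathbf p,:)^{-1}\mathbf V(\mathbf p,:)\in\mathbb R^{r\times s}$. Then: (i) if $\mathbf P^T\mathbf V\mathbf S$ is invertible (so that the following expression is defined), $\hat{\mathbf V}=\mathbf Q\mathbf Z$ is equal to the CUR factorization $$\hat{\mathbf V}=(\mathbf V\mathbf S)\,(\mathbf P^T\mathbf V\mathbf S)^{-1}\,(\mathbf P^T\mathbf V);$$ (ii) the low-rank approximation is exact at the selected rows and columns, i.e. $\mathbf P^T\hat{\mathbf V}=\mathbf P^T\mathbf V$ and $\hat{\mathbf V}\mathbf S=\mathbf V\mathbf S$.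
   Context: $\mathbf I_k$ is the $k\times k$ identity matrix. MATLAB indexing is used: for an index vector $\mathbf p$, $\mathbf A(\mathbf p,:)$ is the submatrix of $\mathbf A$ formed by the rows listed in $\mathbf p$ (in that order), and $\mathbf A(:,\mathbf s)$ is the submatrix formed by the columns listed in $\mathbf s$. Thus $\mathbf P^T\mathbf A=\mathbf A(\mathbf p,:)$ and $\mathbf A\mathbf S=\mathbf A(:,\mathbf s)$. The integer $s$ (number of columns) is distinct from the bold index vector $\mathbf s$. The TDB-CUR algorithm samples $r$ rows and $r$ columns of $\mathbf V$ and forms $\hat{\mathbf V}=\mathbf Q\mathbf Z$ as described in the claim. *)

theory Defs
  imports Complex_Main "Jordan_Normal_Form.Gauss_Jordan_Elimination"
begin

text \<open>
  Rows and columns of a matrix are numbered from 0, so an index vector with entries in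
  \<open>{1..n}\<close> becomes a list with entries in \<open>{..<n}\<close>. The library's \<open>submatrix\<close> takes index sets
  and therefore always keeps the original order; the two selections below follow the
  order of the list.
\<close>

definition rows_at :: "'a mat \<Rightarrow> nat list \<Rightarrow> 'a mat" where
  "rows_at A is = mat (length is) (dim_col A) (\<lambda>(i, j). A $$ (is ! i, j))"

definition cols_at :: "'a mat \<Rightarrow> nat list \<Rightarrow> 'a mat" where
  "cols_at A js = mat (dim_row A) (length js) (\<lambda>(i, j). A $$ (i, js ! j))"

definition orthonormal_cols :: "real mat \<Rightarrow> bool" where
  "orthonormal_cols Q \<longleftrightarrow>
     (\<forall>i < dim_col Q. \<forall>j < dim_col Q. col Q i \<bullet> col Q j = (if i = j then 1 else 0))"

text \<open>
  The thin QR decomposition: \<open>Q\<close> has the shape of \<open>A\<close>, and \<open>R\<close> is square. No sign condition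
  is imposed on the diagonal of \<open>R\<close>, and \<open>R\<close> may be singular.
\<close>

definition qr_decomposition :: "real mat \<Rightarrow> real mat \<Rightarrow> real mat \<Rightarrow> bool" where
  "qr_decomposition A Q R \<longleftrightarrow>
     Q \<in> carrier_mat (dim_row A) (dim_col A) \<and> R \<in> carrier_mat (dim_col A) (dim_col A) \<and>
     orthonormal_cols Q \<and> upper_triangular R \<and> A = Q * R"

text \<open>The value is meaningful only for an invertible matrix.\<close>

abbreviation mat_inv :: "real mat \<Rightarrow> real mat" where
  "mat_inv A \<equiv> the (mat_inverse A)"

end

theory Submission
  imports Defs
begin

text \<open>
  Write \<open>M = P\<^sup>T Q\<close>. Then \<open>P\<^sup>T V S = M R\<close>, and if this is invertible with inverse \<open>N\<close>, then
  \<open>M (R N) = 1\<close>, so \<open>R N = M\<^sup>-\<^sup>1\<close> and the CUR product \<open>Q R N P\<^sup>T V\<close> collapses to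
  \<open>Q M\<^sup>-\<^sup>1 P\<^sup>T V\<close>.
\<close>

text \<open>\<open>mat_inverse\<close> is specified through the units of the ring of k x k matrices,
  so the two-sided inverse given by \<open>invertible_mat\<close> is first recognised as an element
  of that ring. This rules out the result \<open>None\<close>, and \<open>the\<close> is then
  meaningful.\<close>

lemma mat_inv:
  assumes A: "A \<in> carrier_mat k k" and inv: "invertible_mat A"
  shows mat_inv_closed: "mat_inv A \<in> carrier_mat k k"
    and mat_inv_right: "A * mat_inv A = 1\<^sub>m k"
    and mat_inv_left: "mat_inv A * A = 1\<^sub>m k"
proof -
  obtain B where AB: "A * B = 1\<^sub>m (dim_row A)" and BA: "B * A = 1\<^sub>m (dim_row B)"
    using inv unfolding invertible_mat_def inverts_mat_def by auto
  \<comment> \<open>\<open>invertible_mat\<close> does not state the shape of \<open>B\<close>.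
    Comparing the column counts in \<open>AB\<close> gives its width, those in \<open>BA\<close> its
    height.\<close>
  have "B \<in> carrier_mat k k"
    using arg_cong[OF AB, of dim_col] arg_cong[OF BA, of dim_col] A by auto
  then have "A \<in> Units (ring_mat TYPE(real) k ())"
    using A AB BA by (auto simp: Units_def ring_mat_simps)
  then obtain C where C: "mat_inverse A = Some C"
    using mat_inverse(1)[OF A, of "()"] by (cases "mat_inverse A") auto
  show "mat_inv A \<in> carrier_mat k k" "A * mat_inv A = 1\<^sub>m k" "mat_inv A * A = 1\<^sub>m k"
    using mat_inverse(2)[OF A C] C by auto
qed

text \<open>The selected columns of the identity are unit vectors, and multiplying by a unit vector
  picks out one column. This links the index selections of the algorithm with products by
  \<open>P\<close> and \<open>S\<close>.\<close>

lemma cols_at_eq_mult: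
  fixes A :: "'a :: semiring_1 mat"
  assumes "A \<in> carrier_mat m k" and "set js \<subseteq> {..<k}"
  shows "cols_at A js = A * cols_at (1\<^sub>m k) js"
proof (rule eq_matI)
  fix i j
  assume "i < dim_row (A * cols_at (1\<^sub>m k) js)" and "j < dim_col (A * cols_at (1\<^sub>m k) js)"
  then have i: "i < m" and j: "j < length js" using assms by (auto simp: cols_at_def)
  then have "js ! j < k" using assms(2) nth_mem by blast
  moreover from this have "col (cols_at (1\<^sub>m k :: 'a mat) js) j = unit_vec k (js ! j)"
    using j by (intro eq_vecI) (auto simp: cols_at_def)
  ultimately show "cols_at A js $$ (i, j) = (A * cols_at (1\<^sub>m k) js) $$ (i, j)"
    using assms(1) i j by (simp add: cols_at_def)
qed (use assms in \<open>auto simp: cols_at_def\<close>)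

lemma rows_at_eq_mult:
  fixes A :: "'a :: semiring_1 mat"
  assumes "A \<in> carrier_mat k m" and "set is \<subseteq> {..<k}"
  shows "rows_at A is = (cols_at (1\<^sub>m k) is)\<^sup>T * A"
proof (rule eq_matI)
  fix i j
  assume "i < dim_row ((cols_at (1\<^sub>m k) is)\<^sup>T * A)" and "j < dim_col ((cols_at (1\<^sub>m k) is)\<^sup>T * A)"
  then have i: "i < length is" and j: "j < m" using assms by (auto simp: cols_at_def)
  then have "is ! i < k" using assms(2) nth_mem by blast
  \<comment> \<open>Row \<open>i\<close> of the transpose is this column, so entry (i, j) of the
    product is a unit vector times column \<open>j\<close> of \<open>A\<close>.\<close>
  moreover from this have "col (cols_at (1\<^sub>m k :: 'a mat) is) i = unit_vec k (is ! i)"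
    using i by (intro eq_vecI) (auto simp: cols_at_def)
  ultimately show "rows_at A is $$ (i, j) = ((cols_at (1\<^sub>m k) is)\<^sup>T * A) $$ (i, j)"
    using assms(1) i j by (simp add: rows_at_def cols_at_def)
qed (use assms in \<open>auto simp: rows_at_def cols_at_def\<close>)

theorem theorem1:
  fixes n s r :: nat
    and V P S Q R Z Vhat :: "real mat"
    and ps ss :: "nat list"
  assumes "n > 0" and "s > 0" and "r > 0" and "r \<le> min n s"
    and "V \<in> carrier_mat n s"
    and "length ps = r" and "distinct ps" and "set ps \<subseteq> {..<n}"
    and "length ss = r" and "distinct ss" and "set ss \<subseteq> {..<s}"
    and "P = cols_at (1\<^sub>m n) ps" and "S = cols_at (1\<^sub>m s) ss"
    and "qr_decomposition (cols_at V ss) Q R"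
    and "invertible_mat (rows_at Q ps)"
    and "Z = mat_inv (rows_at Q ps) * rows_at V ps"
    and "Vhat = Q * Z"
  shows "(invertible_mat (P\<^sup>T * V * S) \<longrightarrow>
            Vhat = (V * S) * mat_inv (P\<^sup>T * V * S) * (P\<^sup>T * V)) \<and>
         (P\<^sup>T * Vhat = P\<^sup>T * V \<and> Vhat * S = V * S)"
proof -
  note V = assms(5)
  have P: "P \<in> carrier_mat n r" and S: "S \<in> carrier_mat s r"
    using assms(6,9,12,13) by (auto simp: cols_at_def)
  \<comment> \<open>With this the QR hypothesis reads \<open>V * S = Q * R\<close>, and the shapes
    of \<open>Q\<close> and \<open>R\<close> can be read off.\<close>
  have VS: "cols_at V ss = V * S"
    using cols_at_eq_mult[OF V assms(11)] assms(13) by simp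
  have Q: "Q \<in> carrier_mat n r" and R: "R \<in> carrier_mat r r" and QR: "V * S = Q * R"
    using assms(14) V S unfolding qr_decomposition_def VS by auto
  define M where "M = P\<^sup>T * Q"
  define W where "W = P\<^sup>T * V"
  define M' where "M' = mat_inv M"
  have PT: "P\<^sup>T \<in> carrier_mat r n" using P by simp
  have M: "M \<in> carrier_mat r r" and W: "W \<in> carrier_mat r s"
    using PT Q V by (auto simp: M_def W_def)
  have rows: "rows_at Q ps = M" "rows_at V ps = W"
    using rows_at_eq_mult[OF Q assms(8)] rows_at_eq_mult[OF V assms(8)] assms(12)
    by (simp_all add: M_def W_def)
  have M': "M' \<in> carrier_mat r r" "M * M' = 1\<^sub>m r" "M' * M = 1\<^sub>m r"
    using mat_inv[OF M] assms(15) by (simp_all add: M'_def rows)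
  have Vhat: "Vhat = Q * (M' * W)"
    using assms(16,17) by (simp add: M'_def rows)
  have WS: "W * S = M * R"
  proof -
    have "W * S = P\<^sup>T * (V * S)" unfolding W_def by (rule assoc_mult_mat[OF PT V S])
    also have "\<dots> = M * R" unfolding QR M_def by (rule assoc_mult_mat[OF PT Q R, symmetric])
    finally show ?thesis .
  qed
  \<comment> \<open>Exactness on the rows: \<open>P\<^sup>T\<close> turns the leading
    \<open>Q\<close> into \<open>M\<close>, which cancels against \<open>M'\<close>.\<close>
  have "P\<^sup>T * Vhat = M * (M' * W)"
    unfolding Vhat M_def using PT Q M' W by (intro assoc_mult_mat[symmetric]) auto
  also have "\<dots> = W"
    using assoc_mult_mat[OF M M'(1) W] M' W by simp
  finally have i: "P\<^sup>T * Vhat = P\<^sup>T * V" unfolding W_def .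
  \<comment> \<open>Exactness on the columns: \<open>S\<close> turns \<open>W\<close> into
    \<open>M * R\<close>, so \<open>M'\<close> cancels \<open>M\<close> and
    \<open>Q * R = V * S\<close> remains.\<close>
  have "Vhat * S = Q * (M' * W * S)"
    unfolding Vhat using Q M' W S by (intro assoc_mult_mat) auto
  also have "M' * W * S = M' * (M * R)"
    unfolding WS[symmetric] by (rule assoc_mult_mat[OF M'(1) W S])
  also have "\<dots> = R"
    using assoc_mult_mat[OF M'(1) M R] M' R by simp
  finally have ii: "Vhat * S = V * S" by (simp add: QR)
  \<comment> \<open>The product in the CUR formula associates to the left, so \<open>W * S\<close>
    is literally its middle matrix once \<open>W\<close> is unfolded.\<close>
  have "Vhat = (V * S) * mat_inv (W * S) * W" if inv: "invertible_mat (W * S)"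
  proof -
    define N where "N = mat_inv (W * S)"
    have "W * S \<in> carrier_mat r r" using W S by auto
    then have N: "N \<in> carrier_mat r r" and right: "M * R * N = 1\<^sub>m r"
      using mat_inv inv unfolding N_def by (auto simp flip: WS)
    have RN: "R * N \<in> carrier_mat r r" using R N by auto
    \<comment> \<open>\<open>R * N\<close> is a right inverse of \<open>M\<close>. Inserting
      \<open>M' * M = 1\<close> on the left identifies it with \<open>M'\<close> without forming an
      inverse of \<open>R\<close>.\<close>
    have "R * N = M' * (M * (R * N))"
      unfolding assoc_mult_mat[OF M'(1) M RN, symmetric] M'(3) left_mult_one_mat[OF RN] ..
    also have "\<dots> = M'"
      unfolding assoc_mult_mat[OF M R N, symmetric] right by (rule right_mult_one_mat[OF M'(1)])
    finally have "R * N = M'" .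
    then have "(V * S) * N * W = Q * M' * W"
      unfolding QR using assoc_mult_mat[OF Q R N] by simp
    also have "\<dots> = Vhat" unfolding Vhat by (rule assoc_mult_mat[OF Q M'(1) W])
    finally show ?thesis unfolding N_def by simp
  qed
  with i ii show ?thesis unfolding W_def by blast
qed

end
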